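(* Let $X$ be a Corson compactum. Then $X^\omega$ has a dense metrizable subspace if and only if $\hat{c}(X^\omega) > w(X)$.
   Context: A compact Hausdorff space $X$ is a Corson compactum if for some cardinal $\kappa$ it is homeomorphic to a subspace of $\Sigma(\mathbb{R}^\kappa)=\{x \in \mathbb{R}^\kappa : |\{\alpha<\kappa: x(\alpha)\neq 0\}| \leq \aleph_0\}$. $w(X)$ is the weight of $X$. A cellular family is a family of pairwise disjoint non-empty open sets; $\hat{c}(Z)$ denotes the least cardinal $\kappa$ such that $Z$ has no cellular family of cardinality $\kappa$. $X^\omega$ carries the product topology. *)

theory Defs
  imports "HOL-Analysis.Analysis"
begin

definition Sigma_product :: "'k set \<Rightarrow> ('k \<Rightarrow> real) topology" where
  "Sigma_product K =
     subtopology (product_topology (\<lambda>_. euclideanreal) K)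
       {x \<in> topspace (product_topology (\<lambda>_. euclideanreal) K). countable {\<alpha>\<in>K. x \<alpha> \<noteq> 0}}"

definition Corson_compactum_on :: "'a topology \<Rightarrow> 'k set \<Rightarrow> bool" where
  "Corson_compactum_on X K \<longleftrightarrow> compact_space X \<and> Hausdorff_space X \<and>
     (\<exists>S. S \<subseteq> topspace (Sigma_product K) \<and> X homeomorphic_space subtopology (Sigma_product K) S)"

definition is_base :: "'a topology \<Rightarrow> 'a set set \<Rightarrow> bool" where
  "is_base X \<B> \<longleftrightarrow> (\<forall>B\<in>\<B>. openin X B) \<and>
     (\<forall>U. openin X U \<longrightarrow> (\<exists>\<V>. \<V> \<subseteq> \<B> \<and> \<Union>\<V> = U))"

definition weight_base :: "'a topology \<Rightarrow> 'a set set \<Rightarrow> bool" where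
  "weight_base X \<B> \<longleftrightarrow> is_base X \<B> \<and> (\<forall>\<B>'. is_base X \<B>' \<longrightarrow> (card_of \<B>, card_of \<B>') \<in> ordLeq)"

definition cellular :: "'a topology \<Rightarrow> 'a set set \<Rightarrow> bool" where
  "cellular Z \<U> \<longleftrightarrow> (\<forall>U\<in>\<U>. openin Z U \<and> U \<noteq> {}) \<and> pairwise disjnt \<U>"

text \<open>chat(Z) > |A|: chat(Z) is the least cardinal kappa such that Z has no cellular family
  of cardinality kappa; it exceeds |A| iff every cardinal kappa <= |A| (represented by
  a subset C of A) is the cardinality of some cellular family of Z.\<close>
definition chat_greater :: "'a topology \<Rightarrow> 'b set \<Rightarrow> bool" where
  "chat_greater Z A \<longleftrightarrow> (\<forall>C. C \<subseteq> A \<longrightarrow> (\<exists>\<U>. cellular Z \<U> \<and> (card_of \<U>, card_of C) \<in> ordIso))"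

definition has_dense_metrizable_subspace :: "'a topology \<Rightarrow> bool" where
  "has_dense_metrizable_subspace Z \<longleftrightarrow>
     (\<exists>D. D \<subseteq> topspace Z \<and> Z closure_of D = topspace Z \<and> metrizable_space (subtopology Z D))"

definition power_omega :: "'a topology \<Rightarrow> (nat \<Rightarrow> 'a) topology" where
  "power_omega X = product_topology (\<lambda>_. X) (UNIV :: nat set)"

end

theory Submission
  imports Defs "HOL-Library.Equipollence"
begin

text \<open>Write \<open>\<kappa>\<close> for the weight of \<open>X\<close> and identify \<open>X\<close> with a compact subset of a
  \<open>\<Sigma>\<close>-product.

  If \<open>X\<^sup>\<omega>\<close> has a dense metrizable subspace \<open>D\<close>, take maximal \<open>1/n\<close>-separated sets
  \<open>A\<^sub>n \<subseteq> D\<close>. Small balls give cellular families of size \<open>|A\<^sub>n|\<close>, and these are put side by side behind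
  an infinite cellular family of finite-dimensional cylinders, which yields one cellular family of
  size \<open>\<Sigma>\<^sub>n |A\<^sub>n|\<close>. This is at least \<open>\<kappa>\<close>: the union of the \<open>A\<^sub>n\<close> is dense, and \<open>X\<close> is embedded
  already by the coordinates at which some point of a dense set is nonzero.

  Conversely, let \<open>X\<^sup>\<omega>\<close> have a cellular family of size \<open>\<kappa>\<close>. A base of \<open>X\<^sup>\<omega>\<close> of size \<open>\<kappa>\<close>
  consists of boxes that restrict finitely many factors. Shrinking the boxes that restrict the first
  \<open>n\<close> factors by distinct cellular sets placed on the remaining factors makes them disjoint, so
  \<open>X\<^sup>\<omega>\<close> has a \<open>\<sigma>\<close>-disjoint \<open>\<pi>\<close>-base. Every nonempty closed \<open>G\<^sub>\<delta>\<close> of a Corson compactum contains a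
  \<open>G\<^sub>\<delta>\<close> point, and from such points and a \<open>\<sigma>\<close>-disjoint \<open>\<pi>\<close>-base one builds a tree of disjoint open
  sets with marked points; the marked points form the dense metrizable subspace.\<close>

unbundle cardinal_syntax

section \<open>Metrizability from countably many partitions into open sets\<close>

text \<open>The maps \<open>g n\<close> together send \<open>Z\<close> into a countable product of
  discrete spaces, which is metrizable. Open fibres make this map continuous, Hausdorffness and
  small fibres make it injective, and small fibres make it open onto its image.\<close>

lemma metrizable_space_fibres:
  fixes g :: "nat \<Rightarrow> 'a \<Rightarrow> 'c"
  assumes "Hausdorff_space Z"
    and fib: "\<And>n e. e \<in> topspace Z \<Longrightarrow> openin Z {z \<in> topspace Z. g n z = g n e}"
    and nbd: "\<And>U e. openin Z U \<Longrightarrow> e \<in> U \<Longrightarrow> \<exists>n. {z \<in> topspace Z. g n z = g n e} \<subseteq> U"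
  shows "metrizable_space Z"
proof -
  define P where "P = product_topology (\<lambda>_::nat. discrete_topology (UNIV::'c set)) UNIV"
  define f where "f = (\<lambda>z n. g n z)"
  have tP: "topspace P = UNIV"
    by (auto simp: P_def)
  have metP: "metrizable_space P"
    unfolding P_def metrizable_space_product_topology by auto
  have cont: "continuous_map Z P f"
    unfolding P_def continuous_map_componentwise_UNIV
  proof (intro allI)
    fix n
    have "openin Z {x \<in> topspace Z. f x n \<in> U}" for U
    proof -
      have "{x \<in> topspace Z. f x n \<in> U} = \<Union>((\<lambda>e. {z \<in> topspace Z. g n z = g n e}) ` {x \<in> topspace Z. f x n \<in> U})"
        by (auto simp: f_def)
      then show ?thesis
        by (rule ssubst) (intro openin_Union, use fib in auto)
    qed
    then show "continuous_map Z (discrete_topology UNIV) (\<lambda>x. f x n)"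
      by (simp add: continuous_map_def)
  qed
  have inj: "inj_on f (topspace Z)"
  proof (rule inj_onI, rule ccontr)
    fix x y assume xy: "x \<in> topspace Z" "y \<in> topspace Z" "f x = f y" "x \<noteq> y"
    then obtain U where U: "openin Z U" "x \<in> U" "y \<notin> U"
      using assms(1) unfolding Hausdorff_space_def disjnt_iff by metis
    from nbd[OF U(1,2)] obtain n where "{z \<in> topspace Z. g n z = g n x} \<subseteq> U" by blast
    moreover have "g n y = g n x" using xy(3) unfolding f_def by metis
    ultimately show False using xy U by auto
  qed
  have op: "open_map Z (subtopology P (f ` topspace Z)) f"
    unfolding open_map_def
  proof (intro allI impI)
    fix U assume U: "openin Z U"
    then have UZ: "U \<subseteq> topspace Z" by (rule openin_subset)
    define Q where "Q = {(n,e). e \<in> U \<and> {z \<in> topspace Z. g n z = g n e} \<subseteq> U}"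
    define T where "T = (\<Union>(n,e)\<in>Q. {p \<in> topspace P. p n \<in> {g n e}})"
    have "openin P {p \<in> topspace P. p n \<in> {c}}" for n and c :: 'c
      unfolding P_def
      by (rule openin_continuous_map_preimage[OF continuous_map_product_projection]) auto
    then have "openin P T"
      unfolding T_def by (intro openin_Union) auto
    moreover have "f ` U = T \<inter> f ` topspace Z"
    proof
      show "f ` U \<subseteq> T \<inter> f ` topspace Z"
      proof
        fix p assume "p \<in> f ` U"
        then obtain e where e: "e \<in> U" "p = f e" by blast
        with nbd[OF U] obtain n where "(n,e) \<in> Q" unfolding Q_def by blast
        then show "p \<in> T \<inter> f ` topspace Z"
          using e UZ unfolding T_def tP f_def by fastforce
      qed
      show "T \<inter> f ` topspace Z \<subseteq> f ` U"
        unfolding T_def Q_def f_def by fastforce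
    qed
    ultimately show "openin (subtopology P (f ` topspace Z)) (f ` U)"
      unfolding openin_subtopology by blast
  qed
  have "homeomorphic_map Z (subtopology P (f ` topspace Z)) f"
    using op inj cont
    by (intro bijective_open_imp_homeomorphic_map) (auto simp: continuous_map_in_subtopology tP)
  then show ?thesis
    using homeomorphic_map_imp_homeomorphic_space homeomorphic_metrizable_space metP
      metrizable_space_subtopology by blast
qed

section \<open>Points of type \<open>G\<^sub>\<delta>\<close> in Corson compacta\<close>

text \<open>The coordinates of an embedding into a \<Sigma>-product, kept as a family of functions:
  in this form they pass to the countable power without a new embedding.\<close>

definition corson_family :: "'b topology \<Rightarrow> 'k set \<Rightarrow> ('k \<Rightarrow> 'b \<Rightarrow> real) \<Rightarrow> bool" where
  "corson_family Y K f \<longleftrightarrow>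
     (\<forall>\<alpha>\<in>K. continuous_map Y euclideanreal (f \<alpha>)) \<and>
     (\<forall>x\<in>topspace Y. \<forall>y\<in>topspace Y. x \<noteq> y \<longrightarrow> (\<exists>\<alpha>\<in>K. f \<alpha> x \<noteq> f \<alpha> y)) \<and>
     (\<forall>x\<in>topspace Y. countable {\<alpha>\<in>K. f \<alpha> x \<noteq> 0})"

text \<open>The point is maximal in \<open>F\<close> for the order in which \<open>z\<close> extends \<open>y\<close> if it has the same values
  on the support of \<open>y\<close>. As its support is countable, it is a \<open>G\<^sub>\<delta>\<close> point relative to \<open>F\<close>.\<close>
lemma corson_family_maximal_point:
  assumes "compact_space Y" and cf: "corson_family Y K f" and F: "closedin Y F" "F \<noteq> {}"
  obtains d where "d \<in> F" "\<And>z. z \<in> F \<Longrightarrow> (\<And>\<alpha>. \<alpha> \<in> K \<Longrightarrow> f \<alpha> d \<noteq> 0 \<Longrightarrow> f \<alpha> z = f \<alpha> d) \<Longrightarrow> z = d"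
proof -
  define le where "le y z \<longleftrightarrow> (\<forall>\<alpha>\<in>K. f \<alpha> y \<noteq> 0 \<longrightarrow> f \<alpha> z = f \<alpha> y)" for y z
  have FY: "F \<subseteq> topspace Y" using F(1) by (rule closedin_subset)
  have trans: "le x z" if "le x y" "le y z" for x y z
    using that unfolding le_def by metis
  have "\<exists>m\<in>F. \<forall>a\<in>F. le m a \<longrightarrow> a = m"
  proof (rule predicate_Zorn)
    have "x = y" if "x \<in> F" "y \<in> F" "le x y" "le y x" for x y
    proof (rule ccontr)
      assume "x \<noteq> y"
      moreover have "x \<in> topspace Y" "y \<in> topspace Y" using that FY by auto
      ultimately obtain \<alpha> where "\<alpha> \<in> K" "f \<alpha> x \<noteq> f \<alpha> y"
        using cf unfolding corson_family_def by metis
      \<comment> \<open>One of the two values is nonzero, and the matching direction of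
        \<open>le\<close> makes them equal.\<close>
      then show False using that unfolding le_def by metis
    qed
    moreover have "le x x" for x by (simp add: le_def)
    ultimately show "partial_order_on F (relation_of le F)"
      using trans by (intro partial_order_on_relation_ofI) blast+
  next
    fix C assume C: "C \<in> Chains (relation_of le F)"
    then have CF: "C \<subseteq> F" and chain: "\<And>a b. a \<in> C \<Longrightarrow> b \<in> C \<Longrightarrow> le a b \<or> le b a"
      unfolding Chains_def relation_of_def by auto
    \<comment> \<open>The extensions of \<open>y\<close> in \<open>F\<close> form a closed set.
      Along a chain finitely many of these sets share a point, so compactness yields an upper
      bound.\<close>
    define G where "G y = {z \<in> F. le y z}" for y
    have cl: "closedin Y (G y)" for y
    proof -
      have "closedin Y {z \<in> topspace Y. f \<alpha> z \<in> {f \<alpha> y}}" if "\<alpha> \<in> K" for \<alpha>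
        using cf that unfolding corson_family_def
        by (intro closedin_continuous_map_preimage[of Y euclideanreal]) auto
      then have "closedin Y (\<Inter>(insert F ((\<lambda>\<alpha>. {z \<in> topspace Y. f \<alpha> z \<in> {f \<alpha> y}}) ` {\<alpha>\<in>K. f \<alpha> y \<noteq> 0})))"
        using F by (intro closedin_Inter) auto
      moreover have "\<Inter>(insert F ((\<lambda>\<alpha>. {z \<in> topspace Y. f \<alpha> z \<in> {f \<alpha> y}}) ` {\<alpha>\<in>K. f \<alpha> y \<noteq> 0})) = G y"
        unfolding G_def le_def using FY by auto
      ultimately show ?thesis by simp
    qed
    show "\<exists>u\<in>F. \<forall>a\<in>C. le a u"
    proof (cases "C = {}")
      case True then show ?thesis using F by auto
    next
      case False
      have "\<Inter>(G ` C) \<noteq> {}"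
      proof -
        have "\<Inter>\<F> \<noteq> {}" if fin: "finite \<F>" and sub: "\<F> \<subseteq> G ` C" for \<F>
        proof -
          obtain C' where C': "finite C'" "C' \<subseteq> C" "\<F> = G ` C'"
            using finite_subset_image[OF fin sub] by blast
          have "\<exists>c\<in>C. \<forall>a\<in>C'. le a c"
            using C'(1,2)
          proof (induction C' rule: finite_induct)
            case empty then show ?case using False by auto
          next
            case (insert x A)
            then obtain c where c: "c \<in> C" "\<forall>a\<in>A. le a c" by auto
            have "le x x" by (simp add: le_def)
            then show ?case
              using chain[of x c] c insert.prems trans by (metis insert_iff insert_subset)
          qed
          then obtain c where "c \<in> C" "\<forall>a\<in>C'. le a c" by blast
          then have "c \<in> \<Inter>\<F>" using C' CF unfolding G_def by auto
          then show ?thesis by blast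
        qed
        then show ?thesis
          using assms(1)[unfolded compact_space_fip, rule_format, of "G ` C"] cl by blast
      qed
      then obtain u where "u \<in> \<Inter>(G ` C)" by blast
      then show ?thesis using False unfolding G_def by blast
    qed
  qed
  then show ?thesis using that unfolding le_def by blast
qed

lemma regular_space_shrink:
  assumes "regular_space Y" "openin Y U" "x \<in> U"
  obtains V where "openin Y V" "x \<in> V" "Y closure_of V \<subseteq> U"
proof -
  obtain V C where "openin Y V" "closedin Y C" "x \<in> V" "V \<subseteq> C" "C \<subseteq> U"
    using assms unfolding neighbourhood_base_of_closedin[symmetric] neighbourhood_base_of by meson
  then show thesis using that closure_of_minimal by (metis subset_trans)
qed

text \<open>Nested open sets with closures inside successive \<open>G n\<close> have a nonempty
  closed intersection \<open>F\<close>. A maximal point \<open>d\<close> of \<open>F\<close> is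
  determined within \<open>F\<close> by its values on its countable support, and each of these
  values is fixed by countably many open conditions.\<close>

lemma corson_family_gdelta_points:
  assumes comp: "compact_space Y" and haus: "Hausdorff_space Y" and cf: "corson_family Y K f"
    and opO: "\<And>n. openin Y (G n)" and denseO: "\<And>n. Y closure_of G n = topspace Y"
    and W: "openin Y W" "W \<noteq> {}"
  obtains d where "d \<in> W" "gdelta_in Y {d}" "\<And>n::nat. d \<in> G n"
proof -
  have reg: "regular_space Y" using comp haus by (rule compact_Hausdorff_imp_regular_space)
  have shrink: "\<exists>V. openin Y V \<and> V \<noteq> {} \<and> Y closure_of V \<subseteq> U" if "openin Y U" "U \<noteq> {}" for U
    using regular_space_shrink[OF reg that(1)] that(2) by (metis all_not_in_conv)
  define good where "good U \<longleftrightarrow> openin Y U \<and> U \<noteq> {} \<and> Y closure_of U \<subseteq> W" for U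
  have "\<exists>U. \<forall>n. good (U n) \<and> Y closure_of (U (Suc n)) \<subseteq> U n \<inter> G n"
  proof (rule dependent_nat_choice)
    show "\<exists>U. good U" using shrink[OF W] unfolding good_def .
  next
    fix U and n :: nat assume "good U"
    then have "openin Y (U \<inter> G n)" "U \<inter> G n \<noteq> {}"
      using opO denseO[of n] unfolding good_def dense_intersects_open by (auto simp: Int_commute)
    from shrink[OF this] obtain V where V: "openin Y V" "V \<noteq> {}" "Y closure_of V \<subseteq> U \<inter> G n" by blast
    moreover have "U \<subseteq> Y closure_of U" using \<open>good U\<close> unfolding good_def
      by (intro closure_of_subset openin_subset) auto
    ultimately show "\<exists>V. good V \<and> Y closure_of V \<subseteq> U \<inter> G n"
      using \<open>good U\<close> unfolding good_def by blast
  qed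
  then obtain U where U: "\<And>n. good (U n)" "\<And>n. Y closure_of (U (Suc n)) \<subseteq> U n \<inter> G n" by blast
  have cU: "U n \<subseteq> Y closure_of U n" for n
    using U(1)[of n] unfolding good_def by (intro closure_of_subset openin_subset) auto
  define F where "F = (\<Inter>n. Y closure_of U n)"
  have "decseq (\<lambda>n. Y closure_of U n)"
    using order_trans[OF U(2) order_trans[OF Int_lower1 cU]] by (intro decseq_SucI)
  then have Fne: "F \<noteq> {}"
    unfolding F_def
  proof (intro compact_space_imp_nest[OF comp] closedin_closure_of)
    show "Y closure_of U n \<noteq> {}" for n using U(1)[of n] cU[of n] unfolding good_def by auto
  qed
  have Fcl: "closedin Y F" unfolding F_def by (intro closedin_Inter) auto
  \<comment> \<open>The closures interlace with the \<open>U n\<close>, so the closed set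
    \<open>F\<close> is also an intersection of countably many open sets.\<close>
  have FU: "F = (\<Inter>n. U n)"
  proof
    show "F \<subseteq> (\<Inter>n. U n)" unfolding F_def using U(2) by fast
    show "(\<Inter>n. U n) \<subseteq> F" unfolding F_def using cU by fast
  qed
  obtain d where d: "d \<in> F"
    and uniq: "\<And>z. z \<in> F \<Longrightarrow> (\<And>\<alpha>. \<alpha> \<in> K \<Longrightarrow> f \<alpha> d \<noteq> 0 \<Longrightarrow> f \<alpha> z = f \<alpha> d) \<Longrightarrow> z = d"
    using corson_family_maximal_point[OF comp cf Fcl Fne] by metis
  define S where "S = {\<alpha>\<in>K. f \<alpha> d \<noteq> 0}"
  define H where "H = (\<lambda>(\<alpha>, n::nat). {z \<in> topspace Y. f \<alpha> z \<in> ball (f \<alpha> d) (inverse (Suc n))})"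
  have dY: "d \<in> topspace Y" using d Fcl closedin_subset by blast
  have "countable S" using cf dY unfolding S_def corson_family_def by blast
  have "gdelta_in Y (\<Inter>(range U \<union> H ` (S \<times> UNIV)))"
  proof (rule gdelta_in_Inter)
    show "countable (range U \<union> H ` (S \<times> UNIV))" using \<open>countable S\<close> by simp
    fix T assume "T \<in> range U \<union> H ` (S \<times> UNIV)"
    then show "gdelta_in Y T"
    proof
      assume "T \<in> range U" then show ?thesis using U(1) unfolding good_def by (auto intro: open_imp_gdelta_in)
    next
      assume "T \<in> H ` (S \<times> UNIV)"
      then obtain \<alpha> n where "\<alpha> \<in> K" "T = H (\<alpha>, n)" unfolding S_def by auto
      moreover have "openin Y (H (\<alpha>, n))" if "\<alpha> \<in> K"
        unfolding H_def prod.case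
        using cf that unfolding corson_family_def
        by (intro openin_continuous_map_preimage[of Y euclideanreal]) auto
      ultimately show ?thesis by (auto intro: open_imp_gdelta_in)
    qed
  qed auto
  moreover have "\<Inter>(range U \<union> H ` (S \<times> UNIV)) = {d}"
  proof
    show "{d} \<subseteq> \<Inter>(range U \<union> H ` (S \<times> UNIV))" using d FU dY unfolding H_def by auto
    show "\<Inter>(range U \<union> H ` (S \<times> UNIV)) \<subseteq> {d}"
    proof
      fix z assume z: "z \<in> \<Inter>(range U \<union> H ` (S \<times> UNIV))"
      have "f \<alpha> z = f \<alpha> d" if "\<alpha> \<in> K" "f \<alpha> d \<noteq> 0" for \<alpha>
      proof (rule ccontr)
        assume "f \<alpha> z \<noteq> f \<alpha> d"
        then obtain n where "inverse (Suc n) < dist (f \<alpha> d) (f \<alpha> z)"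
          using reals_Archimedean[of "dist (f \<alpha> d) (f \<alpha> z)"] by auto
        moreover have "(\<alpha>, n) \<in> S \<times> UNIV" using that by (simp add: S_def)
        then have "z \<in> H (\<alpha>, n)" using z by fast
        ultimately show False unfolding H_def by auto
      qed
      moreover have "z \<in> F" using z unfolding FU by fast
      ultimately show "z \<in> {d}" using uniq by fast
    qed
  qed
  ultimately have "gdelta_in Y {d}" by simp
  moreover have "d \<in> W" using d U(1)[of 0] unfolding F_def good_def by fast
  moreover have "d \<in> G n" for n using d U(2)[of n] unfolding F_def by fast
  ultimately show thesis by (intro that)
qed

section \<open>Dense metrizable subspaces from a tree of open sets\<close>

text \<open>Level \<open>k\<close> of the tree is a set of pairs \<open>(W, d)\<close> of an open set and a marked point. The
  mark \<open>d\<close> is kept on a small neighbourhood \<open>V\<close>, and the rest of \<open>W\<close> is cut along \<open>\<P> k\<close>. Choosing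
  \<open>V\<close> inside a single member of \<open>\<P> k\<close> ensures that every member of \<open>\<P> k\<close> receives a mark.\<close>
lemma dense_metrizable_of_sigma_disjoint_pi_base:
  fixes Y :: "'b topology" and \<P> :: "nat \<Rightarrow> 'b set set"
  assumes comp: "compact_space Y" and haus: "Hausdorff_space Y"
    and opn: "\<And>k P. P \<in> \<P> k \<Longrightarrow> openin Y P"
    and dis: "\<And>k P Q. P \<in> \<P> k \<Longrightarrow> Q \<in> \<P> k \<Longrightarrow> P \<inter> Q \<noteq> {} \<Longrightarrow> P = Q"
    and base: "\<And>U. openin Y U \<Longrightarrow> U \<noteq> {} \<Longrightarrow> \<exists>k. \<exists>P\<in>\<P> k. P \<noteq> {} \<and> P \<subseteq> U"
    and pts: "\<And>U. openin Y U \<Longrightarrow> U \<noteq> {} \<Longrightarrow> \<exists>d\<in>U. gdelta_in Y {d} \<and> (\<forall>k. d \<in> \<Union>(\<P> k))"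
  shows "has_dense_metrizable_subspace Y"
proof -
  \<comment> \<open>The admissible marks: G-delta points that lie in a member of every
    \<open>\<P> k\<close>. By \<open>pts\<close> they are dense.\<close>
  define D where "D = {d. gdelta_in Y {d} \<and> (\<forall>k. d \<in> \<Union>(\<P> k))}"
  define pt where "pt U = (SOME d. d \<in> U \<inter> D)" for U
  have pt: "pt U \<in> U \<inter> D" if "openin Y U" "U \<noteq> {}" for U
    unfolding pt_def by (rule someI_ex) (use pts[OF that] in \<open>auto simp: D_def\<close>)
  have "\<forall>d\<in>D. \<exists>C. (\<forall>n. openin Y (C n)) \<and> (\<forall>n. C(Suc n) \<subseteq> C n) \<and> \<Inter>(range C) = {d}"
    unfolding D_def gdelta_in_descending by auto
  then obtain N where N: "\<And>d n. d \<in> D \<Longrightarrow> openin Y (N d n)"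
      "\<And>d n. d \<in> D \<Longrightarrow> N d (Suc n) \<subseteq> N d n" "\<And>d. d \<in> D \<Longrightarrow> (\<Inter>n. N d n) = {d}"
    by metis
  have reg: "regular_space Y" using comp haus by (rule compact_Hausdorff_imp_regular_space)
  \<comment> \<open>Closure inside \<open>W\<close> keeps the tree nested; closure inside
    \<open>N d k\<close> makes the sets kept around \<open>d\<close> shrink to
    \<open>d\<close>.\<close>
  define nb where "nb k W d V \<longleftrightarrow> openin Y V \<and> d \<in> V \<and> Y closure_of V \<subseteq> W \<inter> N d k \<and>
      (\<exists>P\<in>\<P> k. Y closure_of V \<subseteq> P)" for k W d V
  define V where "V k W d = (SOME V. nb k W d V)" for k W d
  have V: "nb k W d (V k W d)" if W: "openin Y W" "d \<in> W \<inter> D" for k W d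
    unfolding V_def
  proof (rule someI_ex)
    obtain P where P: "P \<in> \<P> k" "d \<in> P" using W unfolding D_def by blast
    have "d \<in> N d k" using N(3)[of d] W by auto
    then have "openin Y (W \<inter> N d k \<inter> P)" "d \<in> W \<inter> N d k \<inter> P"
      using W N(1)[of d k] opn[OF P(1)] P by auto
    from regular_space_shrink[OF reg this] P show "\<exists>V. nb k W d V"
      unfolding nb_def by (metis le_inf_iff)
  qed
  \<comment> \<open>One child carries on the old mark \<open>d\<close>; the remaining children get
    fresh marks from \<open>pt\<close>.\<close>
  define split where "split k W d = insert (V k W d, d)
      {(W', pt W') | W'. \<exists>P\<in>\<P> k. W' = (W - Y closure_of V k W d) \<inter> P \<and> W' \<noteq> {}}" for k W d
  define T where "T = rec_nat (if topspace Y = {} then {} else {(topspace Y, pt (topspace Y))})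
      (\<lambda>k S. \<Union>(W,d)\<in>S. split k W d)"
  have T0: "T 0 = (if topspace Y = {} then {} else {(topspace Y, pt (topspace Y))})"
    unfolding T_def by simp
  have TS: "T (Suc k) = (\<Union>(W,d)\<in>T k. split k W d)" for k
    unfolding T_def by simp
  have splitD: "openin Y W' \<and> d' \<in> W' \<inter> D \<and> W' \<subseteq> W"
    if "openin Y W" "d \<in> W \<inter> D" "(W',d') \<in> split k W d" for k W d W' d'
    using that(3) unfolding split_def
  proof (elim insertE CollectE exE conjE bexE)
    assume "(W', d') = (V k W d, d)"
    moreover have "V k W d \<subseteq> Y closure_of V k W d" using V[OF that(1,2), of k] unfolding nb_def
      by (intro closure_of_subset openin_subset) auto
    ultimately show ?thesis using V[OF that(1,2), of k] that(2) unfolding nb_def by auto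
  next
    fix W'' P assume *: "(W', d') = (W'', pt W'')" "P \<in> \<P> k"
      "W'' = (W - Y closure_of V k W d) \<inter> P" "W'' \<noteq> {}"
    then have "openin Y W''" using that(1) opn[OF *(2)] openin_diff[OF that(1) closedin_closure_of] by auto
    then show ?thesis using * pt[of W''] by auto
  qed
  have split_disj: "p = q" if W: "openin Y W" "d \<in> W \<inter> D"
    and pq: "p \<in> split k W d" "q \<in> split k W d" "fst p \<inter> fst q \<noteq> {}" for k W d p q
  proof -
    have sub: "V k W d \<subseteq> Y closure_of V k W d" using V[OF W, of k] unfolding nb_def
      by (intro closure_of_subset openin_subset) auto
    from pq show ?thesis using sub dis[of _ k] unfolding split_def by fastforce
  qed
  have Tk: "openin Y W \<and> d \<in> W \<inter> D" if "(W,d) \<in> T k" for k W d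
    using that
  proof (induction k arbitrary: W d)
    case 0
    then show ?case using pt[of "topspace Y"] unfolding T0 by (auto split: if_splits)
  next
    case (Suc k)
    then obtain W0 d0 where "(W0,d0) \<in> T k" "(W,d) \<in> split k W0 d0" unfolding TS by auto
    with Suc.IH[of W0 d0] splitD show ?case by blast
  qed
  have Tdisj: "p = q" if "p \<in> T k" "q \<in> T k" "fst p \<inter> fst q \<noteq> {}" for k p q
    using that
  proof (induction k arbitrary: p q)
    case 0
    then show ?case unfolding T0 by (auto split: if_splits)
  next
    case (Suc k)
    then obtain W d W' d' where *: "(W,d) \<in> T k" "p \<in> split k W d" "(W',d') \<in> T k" "q \<in> split k W' d'"
      unfolding TS by blast
    have "fst p \<subseteq> W" "fst q \<subseteq> W'"
      using splitD Tk * by (metis prod.collapse)+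
    then have "(W,d) = (W',d')" using Suc.IH[OF *(1,3)] Suc.prems by auto
    then show ?case using * Tk split_disj Suc.prems by (metis prod.inject)
  qed
  \<comment> \<open>Each cut loses only the boundary of the kept neighbourhood and points outside
    the dense open set \<open>\<Union>(\<P> k)\<close>.\<close>
  have Tdense: "\<exists>(W,d)\<in>T k. W \<inter> U \<noteq> {}" if "openin Y U" "U \<noteq> {}" for k U
    using that
  proof (induction k arbitrary: U)
    case 0
    from openin_subset[OF 0(1)] 0(2) have "topspace Y \<noteq> {}" "topspace Y \<inter> U \<noteq> {}" by auto
    then show ?case unfolding T0 by simp
  next
    case (Suc k)
    from Suc.IH[OF Suc.prems] obtain W d where W: "(W,d) \<in> T k" "W \<inter> U \<noteq> {}" by blast
    note Wd = Tk[OF W(1)]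
    show ?case
    proof (cases "V k W d \<inter> U = {}")
      case False
      moreover have "(V k W d, d) \<in> T (Suc k)" using W unfolding TS split_def by blast
      ultimately show ?thesis by blast
    next
      case True
      have "Y closure_of V k W d \<inter> U = {}"
        using openin_Int_closure_of_eq_empty[OF Suc.prems(1)] True by (simp add: Int_commute)
      moreover have "openin Y (W \<inter> U)" using Wd Suc.prems by auto
      then obtain x where x: "x \<in> W \<inter> U" "\<forall>k. x \<in> \<Union>(\<P> k)" using pts W by blast
      then obtain P where "P \<in> \<P> k" "x \<in> P" by blast
      moreover define W' where "W' = (W - Y closure_of V k W d) \<inter> P"
      ultimately have "(W', pt W') \<in> split k W d" and "x \<in> W'"
        using x unfolding split_def by blast+
      moreover from this(1) have "(W', pt W') \<in> T (Suc k)" using W(1) unfolding TS by blast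
      ultimately show ?thesis using x(1) by blast
    qed
  qed
  define E where "E = (\<Union>k. snd ` T k)"
  have stay: "\<exists>W. (W,e) \<in> T (m+j)" if "(W0,e) \<in> T m" for W0 e m j
  proof (induction j)
    case 0 then show ?case using that by auto
  next
    case (Suc j)
    then obtain W where "(W,e) \<in> T (m+j)" by blast
    then have "(V (m+j) W e, e) \<in> T (m + Suc j)" unfolding add_Suc_right TS split_def by blast
    then show ?case by blast
  qed
  have down: "\<exists>p\<in>T k. x \<in> fst p" if "p \<in> T (k+j)" "x \<in> fst p" for p k j x
    using that
  proof (induction j arbitrary: p)
    case 0 then show ?case by auto
  next
    case (Suc j)
    then obtain W d where "(W,d) \<in> T (k+j)" "p \<in> split (k+j) W d" unfolding add_Suc_right TS by auto
    then have "x \<in> W" using splitD[of W d "fst p" "snd p" "k+j"] Tk Suc.prems by auto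
    then show ?case using Suc.IH[of "(W,d)"] \<open>(W,d) \<in> T (k+j)\<close> by auto
  qed
  have cover: "\<exists>p\<in>T k. e \<in> fst p" if "e \<in> E" for e k
  proof -
    obtain W m where "(W,e) \<in> T m" using \<open>e \<in> E\<close> unfolding E_def by auto
    then obtain W' where W': "(W',e) \<in> T (m+k)" using stay by blast
    then have "e \<in> W'" using Tk by blast
    with W' down[of "(W',e)" k m e] show ?thesis by (simp add: add.commute)
  qed
  \<comment> \<open>The node of level \<open>k\<close> that contains \<open>e\<close>, unique by
    \<open>Tdisj\<close>. The fibres of \<open>w k\<close> on \<open>E\<close> are traces of open
    nodes, as \<open>metrizable_space_fibres\<close> requires.\<close>
  define w where "w k e = (SOME p. p \<in> T k \<and> e \<in> fst p)" for k e
  have w: "w k e \<in> T k" "e \<in> fst (w k e)" if "e \<in> E" for k e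
    using someI_ex[of "\<lambda>p. p \<in> T k \<and> e \<in> fst p"] cover[OF that] unfolding w_def by blast+
  have wI: "w k e = p" if "e \<in> E" "p \<in> T k" "e \<in> fst p" for k e p
    using Tdisj[OF w(1)[OF that(1)] that(2)] w(2)[OF that(1)] that(3) by blast
  have ED: "E \<subseteq> D" unfolding E_def using Tk by force
  have EY: "E \<subseteq> topspace Y" using ED gdelta_in_subset[of Y] unfolding D_def by blast
  have fibre: "{z \<in> E. w k z = w k e} = fst (w k e) \<inter> E" if "e \<in> E" for k e
    using wI[OF _ w(1)[OF that], of _ k] w(2)[of _ k] by fastforce
  have Edense: "Y closure_of E = topspace Y"
    unfolding dense_intersects_open
  proof (intro allI impI, elim conjE)
    fix U assume "openin Y U" "U \<noteq> {}"
    \<comment> \<open>A node of level \<open>k\<close> meets \<open>P\<close>. If its mark lies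
      outside \<open>P\<close>, the neighbourhood kept around the mark has its closure in another
      member of \<open>\<P> k\<close>, so \<open>P\<close> meets the rest of the node and receives a
      mark at the next level.\<close>
    from base[OF this] obtain k P where P: "P \<in> \<P> k" "P \<noteq> {}" "P \<subseteq> U" by blast
    from Tdense[OF opn[OF P(1)] P(2), of k] obtain W d where W: "(W,d) \<in> T k" "W \<inter> P \<noteq> {}" by blast
    note Wd = Tk[OF W(1)]
    have "d \<in> E" using W unfolding E_def by force
    have "\<exists>e\<in>E. e \<in> P"
    proof (cases "d \<in> P")
      case True then show ?thesis using \<open>d \<in> E\<close> by blast
    next
      case False
      obtain Q where Q: "Q \<in> \<P> k" "Y closure_of V k W d \<subseteq> Q" "d \<in> V k W d"
        using V[of W d k] Wd unfolding nb_def by blast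
      have "V k W d \<subseteq> Y closure_of V k W d" using V[of W d k] Wd unfolding nb_def
        by (intro closure_of_subset openin_subset) auto
      with Q have "d \<in> Q" by blast
      then have "Q \<inter> P = {}" using dis[OF Q(1) P(1)] False by blast
      then have ne: "(W - Y closure_of V k W d) \<inter> P \<noteq> {}" using W Q by blast
      define W' where "W' = (W - Y closure_of V k W d) \<inter> P"
      have "(W', pt W') \<in> split k W d"
        using ne P(1) unfolding split_def W'_def by blast
      then have "(W', pt W') \<in> T (Suc k)" using W unfolding TS by blast
      moreover from Tk[OF this] have "pt W' \<in> P" unfolding W'_def by blast
      ultimately show ?thesis unfolding E_def by force
    qed
    then show "E \<inter> U \<noteq> {}" using P by blast
  qed
  have "metrizable_space (subtopology Y E)"
  proof (rule metrizable_space_fibres[where g = w])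
    show "Hausdorff_space (subtopology Y E)" using haus by (rule Hausdorff_space_subtopology)
    have topE: "topspace (subtopology Y E) = E" using EY by auto
    show "openin (subtopology Y E) {z \<in> topspace (subtopology Y E). w n z = w n e}"
      if "e \<in> topspace (subtopology Y E)" for n e
    proof -
      have "e \<in> E" using that topE by simp
      then have "openin Y (fst (w n e))" using Tk[of "fst (w n e)" "snd (w n e)" n] w(1)[of e n] by simp
      then show ?thesis unfolding topE fibre[OF \<open>e \<in> E\<close>] openin_subtopology by blast
    qed
    fix U e assume U: "openin (subtopology Y E) U" "e \<in> U"
    then obtain U' where U': "openin Y U'" "U = U' \<inter> E" unfolding openin_subtopology by blast
    have "e \<in> E" "e \<in> U'" using U U' by auto
    obtain W m where Wm: "(W,e) \<in> T m" using \<open>e \<in> E\<close> unfolding E_def by auto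
    \<comment> \<open>From level \<open>m\<close> on, \<open>e\<close> is the mark of its own node,
      so the sets \<open>C (Suc j)\<close> are the neighbourhoods kept around
      \<open>e\<close>.\<close>
    define C where "C j = fst (w (m+j) e)" for j
    have C: "(C j, e) \<in> T (m+j)" for j
    proof -
      obtain W' where "(W',e) \<in> T (m+j)" using stay[OF Wm] by blast
      moreover from Tk[OF this] have "e \<in> W'" by blast
      ultimately show ?thesis using wI[OF \<open>e \<in> E\<close>, of "(W',e)" "m+j"] unfolding C_def by simp
    qed
    have CS: "Y closure_of C (Suc j) \<subseteq> C j \<inter> N e (m+j)" for j
    proof -
      have *: "nb (m+j) (C j) e (V (m+j) (C j) e)" using V Tk[OF C[of j]] by blast
      have "(V (m+j) (C j) e, e) \<in> T (m + Suc j)" using C[of j] unfolding add_Suc_right TS split_def by blast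
      moreover have "e \<in> V (m+j) (C j) e" using * unfolding nb_def by blast
      ultimately have "C (Suc j) = V (m+j) (C j) e"
        using wI[OF \<open>e \<in> E\<close>] unfolding C_def[of "Suc j"] by (metis fst_conv)
      then show ?thesis using * unfolding nb_def by simp
    qed
    have Cop: "openin Y (C j)" for j using Tk[OF C] by blast
    have Ccl: "C j \<subseteq> Y closure_of C j" for j by (intro closure_of_subset openin_subset Cop)
    \<comment> \<open>Otherwise compactness puts a point outside \<open>U'\<close> into all these
      closures, but the only point common to them is \<open>e\<close>, by the choice of
      \<open>N e\<close>.\<close>
    have "\<exists>j. Y closure_of C j - U' = {}"
    proof (rule ccontr)
      assume "\<not> ?thesis"
      then have ne: "\<And>j. Y closure_of C j - U' \<noteq> {}" by blast
      have "Y closure_of C (Suc j) \<subseteq> Y closure_of C j" for j using CS[of j] Ccl[of j] by blast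
      then have "decseq (\<lambda>j. Y closure_of C j - U')" by (intro decseq_SucI) blast
      then have "(\<Inter>j. Y closure_of C j - U') \<noteq> {}"
        by (intro compact_space_imp_nest[OF comp] closedin_diff closedin_closure_of U' ne)
      then obtain x where x: "\<And>j. x \<in> Y closure_of C j - U'" by blast
      have "decseq (N e)" using N(2)[of e] ED \<open>e \<in> E\<close> by (intro decseq_SucI) blast
      have "x \<in> N e n" for n
      proof -
        have "x \<in> N e (m+n)" using x[of "Suc n"] CS[of n] by blast
        moreover have "N e (m+n) \<subseteq> N e n" using \<open>decseq (N e)\<close> by (simp add: decseqD)
        ultimately show ?thesis by blast
      qed
      then have "x = e" using N(3)[of e] ED \<open>e \<in> E\<close> by blast
      then show False using x \<open>e \<in> U'\<close> by blast
    qed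
    then obtain j where j: "Y closure_of C j \<subseteq> U'" by blast
    have "{z \<in> E. w (m+j) z = w (m+j) e} \<subseteq> U"
      unfolding fibre[OF \<open>e \<in> E\<close>] U'(2) using j Ccl[of j] unfolding C_def by blast
    then show "\<exists>n. {z \<in> topspace (subtopology Y E). w n z = w n e} \<subseteq> U" unfolding topE by blast
  qed
  then show ?thesis unfolding has_dense_metrizable_subspace_def using EY Edense by blast
qed

text \<open>The members of \<open>\<P> k\<close> may fail to have a dense union. Adding the
  complement \<open>R k\<close> of the closure of the union repairs this and keeps each level
  disjoint; the marks then come from \<open>corson_family_gdelta_points\<close>.\<close>

lemma corson_family_dense_metrizable:
  fixes Y :: "'b topology" and \<P> :: "nat \<Rightarrow> 'b set set"
  assumes comp: "compact_space Y" and haus: "Hausdorff_space Y" and cf: "corson_family Y K f"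
    and opn: "\<And>k P. P \<in> \<P> k \<Longrightarrow> openin Y P"
    and dis: "\<And>k P Q. P \<in> \<P> k \<Longrightarrow> Q \<in> \<P> k \<Longrightarrow> P \<inter> Q \<noteq> {} \<Longrightarrow> P = Q"
    and base: "\<And>U. openin Y U \<Longrightarrow> U \<noteq> {} \<Longrightarrow> \<exists>k. \<exists>P\<in>\<P> k. P \<noteq> {} \<and> P \<subseteq> U"
  shows "has_dense_metrizable_subspace Y"
proof -
  define R where "R k = topspace Y - Y closure_of \<Union>(\<P> k)" for k
  define \<Q> where "\<Q> k = insert (R k) (\<P> k)" for k
  have Rop: "openin Y (R k)" for k unfolding R_def by (intro openin_diff) auto
  have RP: "R k \<inter> P = {}" if "P \<in> \<P> k" for k P
  proof -
    have "\<Union>(\<P> k) \<subseteq> Y closure_of \<Union>(\<P> k)"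
      by (intro closure_of_subset openin_subset openin_Union opn)
    then show ?thesis using that unfolding R_def by blast
  qed
  have opQ: "openin Y P" if "P \<in> \<Q> k" for k P using that opn Rop unfolding \<Q>_def by blast
  have dense: "Y closure_of \<Union>(\<Q> k) = topspace Y" for k
    unfolding dense_intersects_open
  proof (intro allI impI, elim conjE)
    fix U assume U: "openin Y U" "U \<noteq> {}"
    show "\<Union>(\<Q> k) \<inter> U \<noteq> {}"
    proof (cases "\<Union>(\<P> k) \<inter> U = {}")
      case True
      then have "U \<inter> Y closure_of \<Union>(\<P> k) = {}"
        using openin_Int_closure_of_eq_empty[OF U(1)] by (simp add: Int_commute)
      then have "U \<subseteq> R k" using openin_subset[OF U(1)] unfolding R_def by blast
      then show ?thesis using U unfolding \<Q>_def by blast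
    next
      case False then show ?thesis unfolding \<Q>_def by blast
    qed
  qed
  show ?thesis
  proof (rule dense_metrizable_of_sigma_disjoint_pi_base[OF comp haus opQ])
    show "P = Q" if "P \<in> \<Q> k" "Q \<in> \<Q> k" "P \<inter> Q \<noteq> {}" for k P Q
      using that dis[of P k Q] RP[of P k] RP[of Q k] unfolding \<Q>_def by blast
    show "\<exists>k. \<exists>P\<in>\<Q> k. P \<noteq> {} \<and> P \<subseteq> U" if "openin Y U" "U \<noteq> {}" for U
      using base[OF that] unfolding \<Q>_def by blast
    show "\<exists>d\<in>U. gdelta_in Y {d} \<and> (\<forall>k. d \<in> \<Union>(\<Q> k))" if U: "openin Y U" "U \<noteq> {}" for U
    proof -
      have "openin Y (\<Union>(\<Q> k))" for k using opQ by blast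
      from corson_family_gdelta_points[of _ _ _ "\<lambda>k. \<Union>(\<Q> k)", OF comp haus cf this dense U] show ?thesis by metis
    qed
  qed
qed

lemma Corson_compactum_imp_family:
  assumes "Corson_compactum_on X K"
  obtains f where "corson_family X K f"
proof -
  obtain S h where S: "S \<subseteq> topspace (Sigma_product K)"
    and h: "homeomorphic_map X (subtopology (Sigma_product K) S) h"
    using assms unfolding Corson_compactum_on_def homeomorphic_space by blast
  have cont: "continuous_map X (subtopology (Sigma_product K) S) h"
    using h by (rule homeomorphic_imp_continuous_map)
  then have cont': "continuous_map X (product_topology (\<lambda>_. euclideanreal) K) h"
    unfolding Sigma_product_def by (auto simp: continuous_map_in_subtopology)
  have inj: "inj_on h (topspace X)" using h by (rule homeomorphic_imp_injective_map)
  have im: "h x \<in> topspace (Sigma_product K)" if "x \<in> topspace X" for x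
    using continuous_map_image_subset_topspace[OF cont] that by auto
  have "corson_family X K (\<lambda>\<alpha> x. h x \<alpha>)"
    unfolding corson_family_def
  proof (intro conjI ballI impI)
    fix \<alpha> assume "\<alpha> \<in> K"
    then show "continuous_map X euclideanreal (\<lambda>x. h x \<alpha>)"
      using cont' unfolding continuous_map_componentwise by blast
  next
    fix x y assume xy: "x \<in> topspace X" "y \<in> topspace X" "x \<noteq> y"
    then have "h x \<noteq> h y" using inj unfolding inj_on_def by blast
    \<comment> \<open>Points of the product are extensional, so distinct ones differ at an index in
      \<open>K\<close>.\<close>
    moreover have "h x \<in> extensional K" "h y \<in> extensional K"
      using im xy unfolding Sigma_product_def by (auto simp: PiE_def)
    ultimately show "\<exists>\<alpha>\<in>K. h x \<alpha> \<noteq> h y \<alpha>" using extensionalityI by metis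
  next
    fix x assume "x \<in> topspace X"
    then show "countable {\<alpha> \<in> K. h x \<alpha> \<noteq> 0}"
      using im[of x] unfolding Sigma_product_def by auto
  qed
  then show thesis by (rule that)
qed

section \<open>The countable power\<close>

lemma topspace_power_omega: "topspace (power_omega X) = {x. \<forall>n. x n \<in> topspace X}"
  unfolding power_omega_def by (auto simp: PiE_iff)

lemma continuous_map_power_omega_component: "continuous_map (power_omega X) X (\<lambda>x. x n)"
  unfolding power_omega_def by (rule continuous_map_product_projection) simp

text \<open>A support in the power is a countable union of countable supports, one for each
  factor.\<close>

lemma corson_family_power_omega:
  assumes "corson_family X K f"
  shows "corson_family (power_omega X) (K \<times> UNIV) (\<lambda>(\<alpha>, n) x. f \<alpha> (x n))"
  unfolding corson_family_def
proof (intro conjI ballI impI)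
  fix p :: "'b \<times> nat" assume "p \<in> K \<times> UNIV"
  then obtain \<alpha> n where p: "p = (\<alpha>, n)" "\<alpha> \<in> K" by auto
  have "continuous_map (power_omega X) euclideanreal (f \<alpha> \<circ> (\<lambda>x. x n))"
    using assms p(2) unfolding corson_family_def
    by (intro continuous_map_compose[OF continuous_map_power_omega_component]) auto
  then show "continuous_map (power_omega X) euclideanreal (case p of (\<alpha>, n) \<Rightarrow> \<lambda>x. f \<alpha> (x n))"
    using p by (simp add: comp_def)
next
  fix x y assume xy: "x \<in> topspace (power_omega X)" "y \<in> topspace (power_omega X)" "x \<noteq> y"
  then obtain n where "x n \<noteq> y n" by auto
  moreover have "x n \<in> topspace X" "y n \<in> topspace X" using xy by (auto simp: topspace_power_omega)
  ultimately obtain \<alpha> where "\<alpha> \<in> K" "f \<alpha> (x n) \<noteq> f \<alpha> (y n)"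
    using assms unfolding corson_family_def by metis
  then show "\<exists>p\<in>K \<times> UNIV. (case p of (\<alpha>, n) \<Rightarrow> \<lambda>x. f \<alpha> (x n)) x \<noteq> (case p of (\<alpha>, n) \<Rightarrow> \<lambda>x. f \<alpha> (x n)) y"
    by (intro bexI[of _ "(\<alpha>, n)"]) auto
next
  fix x assume x: "x \<in> topspace (power_omega X)"
  have "countable (\<Union>n. (\<lambda>\<alpha>. (\<alpha>, n)) ` {\<alpha> \<in> K. f \<alpha> (x n) \<noteq> 0})"
    using assms x unfolding corson_family_def topspace_power_omega
    by (intro countable_UN countable_image) auto
  then show "countable {p \<in> K \<times> UNIV. (case p of (\<alpha>, n) \<Rightarrow> \<lambda>x. f \<alpha> (x n)) x \<noteq> 0}"
    by (rule countable_subset[rotated]) auto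
qed

text \<open>Basic boxes are coded by lists: with an initial segment of factors restricted, boxes can
  be sorted by length and their number bounded by that of lists.\<close>

definition prefix_box :: "'a topology \<Rightarrow> 'a set list \<Rightarrow> (nat \<Rightarrow> 'a) set" where
  "prefix_box X bs = {x \<in> topspace (power_omega X). \<forall>i<length bs. x i \<in> bs ! i}"

text \<open>Together with \<open>splice_at\<close> this uses that the factors from \<open>n\<close>
  on form another copy of the power: an open set can be imposed there independently of the first
  \<open>n\<close> factors.\<close>

definition shift :: "nat \<Rightarrow> (nat \<Rightarrow> 'a) \<Rightarrow> nat \<Rightarrow> 'a" where
  "shift n x = (\<lambda>i. x (n + i))"

definition splice_at :: "nat \<Rightarrow> (nat \<Rightarrow> 'a) \<Rightarrow> (nat \<Rightarrow> 'a) \<Rightarrow> nat \<Rightarrow> 'a" where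
  "splice_at n x y = (\<lambda>i. if i < n then x i else y (i - n))"

lemma shift_splice_at [simp]: "shift n (splice_at n x y) = y"
  by (auto simp: shift_def splice_at_def)

lemma splice_at_topspace:
  "x \<in> topspace (power_omega X) \<Longrightarrow> y \<in> topspace (power_omega X) \<Longrightarrow>
    splice_at n x y \<in> topspace (power_omega X)"
  by (auto simp: splice_at_def topspace_power_omega)

lemma splice_at_prefix_box:
  "x \<in> prefix_box X bs \<Longrightarrow> y \<in> topspace (power_omega X) \<Longrightarrow> splice_at (length bs) x y \<in> prefix_box X bs"
  unfolding prefix_box_def using splice_at_topspace by (auto simp: splice_at_def)

lemma openin_prefix_box:
  assumes "\<And>b. b \<in> set bs \<Longrightarrow> openin X b"
  shows "openin (power_omega X) (prefix_box X bs)"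
proof -
  have "openin (power_omega X) {x \<in> topspace (power_omega X). x i \<in> bs ! i}" if "i < length bs" for i
    using that assms by (intro openin_continuous_map_preimage[OF continuous_map_power_omega_component]) auto
  then have "openin (power_omega X) (\<Inter>(insert (topspace (power_omega X))
      ((\<lambda>i. {x \<in> topspace (power_omega X). x i \<in> bs ! i}) ` {..<length bs})))"
    by (intro openin_Inter) auto
  moreover have "\<Inter>(insert (topspace (power_omega X))
      ((\<lambda>i. {x \<in> topspace (power_omega X). x i \<in> bs ! i}) ` {..<length bs})) = prefix_box X bs"
    unfolding prefix_box_def by auto
  ultimately show ?thesis by simp
qed

lemma openin_shift_preimage:
  assumes "openin (power_omega X) U"
  shows "openin (power_omega X) {x \<in> topspace (power_omega X). shift n x \<in> U}"
proof (rule openin_continuous_map_preimage[OF _ assms])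
  show "continuous_map (power_omega X) (power_omega X) (shift n)"
    unfolding shift_def
    by (subst (2) power_omega_def)
      (auto simp: continuous_map_componentwise_UNIV continuous_map_power_omega_component)
qed

text \<open>A basic neighbourhood restricts finitely many factors, all below some \<open>n\<close>;
  base sets are chosen at every coordinate below \<open>n\<close>, also at those left free.\<close>

lemma prefix_box_neighbourhood:
  assumes base: "is_base X \<B>" and U: "openin (power_omega X) U" "x \<in> U"
  obtains bs where "bs \<in> lists \<B>" "x \<in> prefix_box X bs" "prefix_box X bs \<subseteq> U"
proof -
  obtain V where V: "finite {i. V i \<noteq> topspace X}" "\<And>i. openin X (V i)" "\<And>i. x i \<in> V i" "Pi UNIV V \<subseteq> U"
    using U unfolding power_omega_def openin_product_topology_alt by (force simp: PiE_UNIV_domain)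
  obtain n where n: "\<And>i. V i \<noteq> topspace X \<Longrightarrow> i < n"
    using V(1) unfolding finite_nat_set_iff_bounded by blast
  have "\<exists>b\<in>\<B>. x i \<in> b \<and> b \<subseteq> V i" for i
  proof -
    obtain \<V> where "\<V> \<subseteq> \<B>" "\<Union>\<V> = V i" using base V(2)[of i] unfolding is_base_def by meson
    moreover have "x i \<in> \<Union>\<V>" using V(3)[of i] \<open>\<Union>\<V> = V i\<close> by simp
    ultimately show ?thesis by (metis Union_iff Union_upper subsetD)
  qed
  then obtain b where b: "\<And>i. b i \<in> \<B>" "\<And>i. x i \<in> b i" "\<And>i. b i \<subseteq> V i" by metis
  have xt: "x \<in> topspace (power_omega X)" using U openin_subset by blast
  show thesis
  proof (rule that[of "map b [0..<n]"])
    show "map b [0..<n] \<in> lists \<B>" using b by auto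
    show "x \<in> prefix_box X (map b [0..<n])" using xt b by (auto simp: prefix_box_def)
    have "y i \<in> V i" if "y \<in> prefix_box X (map b [0..<n])" for y i
    proof (cases "i < n")
      case True then show ?thesis using that b(3)[of i] by (auto simp: prefix_box_def)
    next
      case False
      then have "V i = topspace X" using n by blast
      then show ?thesis using that by (auto simp: prefix_box_def topspace_power_omega)
    qed
    then show "prefix_box X (map b [0..<n]) \<subseteq> U" using V(4) by blast
  qed
qed

section \<open>Cardinal bounds for products and lists\<close>

lemma lepoll_iff_card_of_ordLeq: "A \<lesssim> B \<longleftrightarrow> |A| \<le>o |B|"
  unfolding lepoll_def using card_of_ordLeq by auto

lemma infinite_times_lepoll:
  assumes "infinite A" "B \<lesssim> A"
  shows "A \<times> B \<lesssim> A"
proof -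
  have "A \<times> B \<lesssim> A \<times> A" using assms(2) by (intro times_lepoll_mono) auto
  also have "A \<times> A \<lesssim> A"
    using card_of_Times_same_infinite[OF assms(1)] ordIso_imp_ordLeq
    by (simp add: lepoll_iff_card_of_ordLeq)
  finally show ?thesis .
qed

lemma lists_lepoll_infinite:
  assumes "infinite A"
  shows "lists A \<lesssim> A"
proof -
  have len: "{xs \<in> lists A. length xs = n} \<lesssim> A" for n
  proof (induction n)
    case 0
    have "{xs \<in> lists A. length xs = 0} = {[]}" by auto
    then show ?case using assms by (simp add: finite_lepoll_infinite)
  next
    case (Suc n)
    have "{xs \<in> lists A. length xs = Suc n} \<subseteq> (\<lambda>(a, xs). a # xs) ` (A \<times> {xs \<in> lists A. length xs = n})"
      by (force simp: length_Suc_conv)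
    then have "{xs \<in> lists A. length xs = Suc n} \<lesssim> A \<times> {xs \<in> lists A. length xs = n}"
      by (rule subset_image_lepoll)
    also have "\<dots> \<lesssim> A" using assms Suc by (rule infinite_times_lepoll)
    finally show ?case .
  qed
  have "(UNIV :: nat set) \<lesssim> A" using assms infinite_le_lepoll by blast
  then have "|\<Union>n. {xs \<in> lists A. length xs = n}| \<le>o |A|"
    using assms len by (intro card_of_UNION_ordLeq_infinite) (auto simp: lepoll_iff_card_of_ordLeq)
  moreover have "(\<Union>n. {xs \<in> lists A. length xs = n}) = lists A" by auto
  ultimately show ?thesis unfolding lepoll_iff_card_of_ordLeq by simp
qed

section \<open>From a large cellular family to a dense metrizable subspace\<close>

lemma compact_Hausdorff_power_omega:
  assumes "compact_space X" "Hausdorff_space X"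
  shows "compact_space (power_omega X)" "Hausdorff_space (power_omega X)"
  using assms unfolding power_omega_def
  by (auto simp: compact_space_product_topology Hausdorff_space_product_topology)

lemma chat_greater_imp_dense_metrizable:
  assumes X: "compact_space X" "Hausdorff_space X" "corson_family X K f"
    and base: "is_base X \<B>" and chat: "chat_greater (power_omega X) \<B>"
  shows "has_dense_metrizable_subspace (power_omega X)"
proof (cases "countable \<B>")
  case True
  \<comment> \<open>A finite \<open>\<B>\<close> can have more lists than elements, so the countable
    case is treated apart: the countably many boxes are spread over the levels, one per
    level.\<close>
  define \<P> where "\<P> k = {prefix_box X (from_nat_into (lists \<B>) k)}" for k
  have ne: "lists \<B> \<noteq> {}" by auto
  have ctb: "countable (lists \<B>)" using True by (rule countable_lists)
  show ?thesis
  proof (rule corson_family_dense_metrizable[where \<P> = \<P>, OF compact_Hausdorff_power_omega[OF X(1,2)] corson_family_power_omega[OF X(3)]])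
    show "openin (power_omega X) P" if "P \<in> \<P> k" for k P
      using that from_nat_into[OF ne, of k] base unfolding \<P>_def is_base_def by (auto intro!: openin_prefix_box)
    show "\<exists>k. \<exists>P\<in>\<P> k. P \<noteq> {} \<and> P \<subseteq> U" if "openin (power_omega X) U" "U \<noteq> {}" for U
    proof -
      obtain x where "x \<in> U" using \<open>U \<noteq> {}\<close> by blast
      then obtain bs where bs: "bs \<in> lists \<B>" "x \<in> prefix_box X bs" "prefix_box X bs \<subseteq> U"
        using prefix_box_neighbourhood[OF base \<open>openin (power_omega X) U\<close>] by blast
      moreover obtain k where "from_nat_into (lists \<B>) k = bs"
        using from_nat_into_surj[OF ctb \<open>bs \<in> lists \<B>\<close>] by blast
      ultimately show ?thesis unfolding \<P>_def by blast
    qed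
  qed (auto simp: \<P>_def)
next
  case False
  then have inf: "infinite \<B>" using countable_finite by blast
  obtain \<U> where \<U>: "cellular (power_omega X) \<U>" "|\<U>| =o |\<B>|"
    using chat unfolding chat_greater_def by blast
  have "lists \<B> \<lesssim> \<B>" using inf by (rule lists_lepoll_infinite)
  also have "\<B> \<approx> \<U>" using \<U>(2) eqpoll_iff_card_of_ordIso eqpoll_sym by blast
  finally obtain g where g: "inj_on g (lists \<B>)" "g ` lists \<B> \<subseteq> \<U>" unfolding lepoll_def by blast
  have gop: "openin (power_omega X) (g bs)" "g bs \<noteq> {}" if "bs \<in> lists \<B>" for bs
    using \<U>(1) g(2) that unfolding cellular_def by blast+
  have gdis: "bs = cs" if "bs \<in> lists \<B>" "cs \<in> lists \<B>" "g bs \<inter> g cs \<noteq> {}" for bs cs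
  proof (rule ccontr)
    assume "bs \<noteq> cs"
    then have "g bs \<noteq> g cs" using g(1) that unfolding inj_on_def by blast
    then show False using \<U>(1) g(2) that unfolding cellular_def pairwise_def disjnt_def by blast
  qed
  \<comment> \<open>The box of \<open>bs\<close> restricts the first \<open>length bs\<close>
    factors and \<open>g bs\<close> only the later ones, so a nonempty box stays nonempty. Boxes of
    equal length become disjoint, since their cellular sets sit behind the same shift.\<close>
  define p where "p bs = prefix_box X bs \<inter> {x \<in> topspace (power_omega X). shift (length bs) x \<in> g bs}" for bs
  define \<P> where "\<P> k = {p bs | bs. bs \<in> lists \<B> \<and> length bs = k}" for k
  show ?thesis
  proof (rule corson_family_dense_metrizable[where \<P> = \<P>, OF compact_Hausdorff_power_omega[OF X(1,2)] corson_family_power_omega[OF X(3)]])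
    have "openin (power_omega X) (p bs)" if "bs \<in> lists \<B>" for bs
      unfolding p_def using that base gop
      by (intro openin_Int openin_prefix_box openin_shift_preimage) (auto simp: is_base_def)
    then show "openin (power_omega X) P" if "P \<in> \<P> k" for k P
      using that unfolding \<P>_def by blast
    show "P = Q" if "P \<in> \<P> k" "Q \<in> \<P> k" "P \<inter> Q \<noteq> {}" for k P Q
    proof -
      obtain bs cs where b: "P = p bs" "bs \<in> lists \<B>" "length bs = k"
          and c: "Q = p cs" "cs \<in> lists \<B>" "length cs = k"
        using \<open>P \<in> \<P> k\<close> \<open>Q \<in> \<P> k\<close> unfolding \<P>_def by blast
      then have "g bs \<inter> g cs \<noteq> {}" using that(3) unfolding p_def by auto
      then show ?thesis using gdis b c by blast
    qed
    show "\<exists>k. \<exists>P\<in>\<P> k. P \<noteq> {} \<and> P \<subseteq> U" if "openin (power_omega X) U" "U \<noteq> {}" for U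
    proof -
      obtain x where "x \<in> U" using \<open>U \<noteq> {}\<close> by blast
      then obtain bs where bs: "bs \<in> lists \<B>" "x \<in> prefix_box X bs" "prefix_box X bs \<subseteq> U"
        using prefix_box_neighbourhood[OF base \<open>openin (power_omega X) U\<close>] by blast
      obtain y where y: "y \<in> g bs" using gop[OF bs(1)] by blast
      then have yt: "y \<in> topspace (power_omega X)" using gop[OF bs(1)] openin_subset by blast
      have "splice_at (length bs) x y \<in> p bs"
        unfolding p_def using splice_at_prefix_box[OF bs(2) yt] y by (simp add: prefix_box_def)
      moreover have "p bs \<subseteq> U" using bs unfolding p_def by blast
      ultimately show ?thesis using bs(1) unfolding \<P>_def by blast
    qed
  qed
qed

section \<open>Cellular families from a dense metrizable subspace\<close>

lemma cellular_image:
  assumes "\<And>i. i \<in> I \<Longrightarrow> openin Z (F i)" "\<And>i. i \<in> I \<Longrightarrow> F i \<noteq> {}"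
    and dis: "\<And>i j. i \<in> I \<Longrightarrow> j \<in> I \<Longrightarrow> F i \<inter> F j \<noteq> {} \<Longrightarrow> i = j"
  shows "cellular Z (F ` I)" "I \<lesssim> F ` I"
proof -
  show "cellular Z (F ` I)"
    unfolding cellular_def pairwise_def disjnt_def using assms by (metis imageE)
  have "inj_on F I" using assms by (intro inj_onI) (metis Int_absorb)
  then show "I \<lesssim> F ` I" by simp
qed

text \<open>Subfamilies of cellular families are cellular, so one family of size at least
  \<open>|A|\<close> serves all smaller cardinals.\<close>

lemma chat_greater_if_lepoll_cellular:
  assumes "cellular Z \<U>" "A \<lesssim> \<U>"
  shows "chat_greater Z A"
  unfolding chat_greater_def
proof (intro allI impI)
  fix C assume "C \<subseteq> A"
  then have "C \<lesssim> \<U>" using assms(2) subset_imp_lepoll lepoll_trans by blast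
  then obtain g where g: "inj_on g C" "g ` C \<subseteq> \<U>" unfolding lepoll_def by blast
  have "cellular Z (g ` C)" using assms(1) g(2) unfolding cellular_def
    by (meson pairwise_subset subsetD)
  moreover have "|g ` C| =o |C|" using g(1) eqpoll_iff_card_of_ordIso inj_on_image_eqpoll_self by blast
  ultimately show "\<exists>\<U>. cellular Z \<U> \<and> |\<U>| =o |C|" by blast
qed

text \<open>The copies of \<open>G n\<close> are placed behind pairwise disjoint prefix cylinders: \<open>n\<close> factors
  \<open>A\<close> followed by a factor \<open>B\<close>.\<close>
lemma cellular_power_omega_Sigma:
  fixes G :: "nat \<Rightarrow> 'i \<Rightarrow> (nat \<Rightarrow> 'a) set"
  assumes X: "Hausdorff_space X" and ab: "a \<in> topspace X" "b \<in> topspace X" "a \<noteq> b"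
    and op: "\<And>n i. i \<in> I n \<Longrightarrow> openin (power_omega X) (G n i)" and ne: "\<And>n i. i \<in> I n \<Longrightarrow> G n i \<noteq> {}"
    and dis: "\<And>n. pairwise (\<lambda>i j. disjnt (G n i) (G n j)) (I n)"
  obtains \<U> where "cellular (power_omega X) \<U>" "Sigma UNIV I \<lesssim> \<U>"
proof -
  obtain A B where AB: "openin X A" "openin X B" "a \<in> A" "b \<in> B" "A \<inter> B = {}"
    using X ab unfolding Hausdorff_space_def disjnt_def by metis
  define bs where "bs n = replicate n A @ [B]" for n
  have bs: "openin X c" if "c \<in> set (bs n)" for n c
    using that AB(1,2) unfolding bs_def by auto
  define u where "u n = (\<lambda>i. if i < n then a else b)" for n :: nat
  have u: "u n \<in> prefix_box X (bs n)" for n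
    unfolding prefix_box_def u_def bs_def using ab AB by (auto simp: topspace_power_omega nth_append)
  have bdis: "m = n" if "x \<in> prefix_box X (bs m)" "x \<in> prefix_box X (bs n)" for x m n
  proof (rule ccontr)
    have less: False if "m < n" "x \<in> prefix_box X (bs m)" "x \<in> prefix_box X (bs n)" for m n
    proof -
      \<comment> \<open>For \<open>m < n\<close>, coordinate \<open>m\<close> lies in
        \<open>B\<close> by the first cylinder and in \<open>A\<close> by the second.\<close>
      have "x m \<in> bs m ! m" "x m \<in> bs n ! m" using that unfolding prefix_box_def bs_def by auto
      then show False using that(1) AB unfolding bs_def by (auto simp: nth_append)
    qed
    assume "m \<noteq> n"
    then show False using less[of m n] less[of n m] that by linarith
  qed
  define F where "F = (\<lambda>(n, i). prefix_box X (bs n) \<inter>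
      {x \<in> topspace (power_omega X). shift (length (bs n)) x \<in> G n i})"
  have Fop: "openin (power_omega X) (F p)" if "p \<in> Sigma UNIV I" for p
    using that bs op unfolding F_def
    by (auto intro!: openin_Int openin_prefix_box openin_shift_preimage)
  have Fne: "F p \<noteq> {}" if "p \<in> Sigma UNIV I" for p
  proof -
    obtain n i where p: "p = (n, i)" "i \<in> I n" using \<open>p \<in> _\<close> by (cases p) auto
    obtain y where y: "y \<in> G n i" using ne p by blast
    then have yt: "y \<in> topspace (power_omega X)" using op p openin_subset by blast
    have "splice_at (length (bs n)) (u n) y \<in> F p"
      using splice_at_prefix_box[OF u yt] y unfolding F_def p(1) by (simp add: prefix_box_def)
    then show ?thesis by blast
  qed
  have Fdis: "p = q" if "p \<in> Sigma UNIV I" "q \<in> Sigma UNIV I" "F p \<inter> F q \<noteq> {}" for p q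
  proof -
    obtain m i n j where p: "p = (m, i)" "i \<in> I m" "q = (n, j)" "j \<in> I n" 
      using \<open>p \<in> _\<close> \<open>q \<in> _\<close> by (cases p, cases q) auto
    obtain x where x: "x \<in> F (m, i)" "x \<in> F (n, j)" using \<open>F p \<inter> F q \<noteq> {}\<close> p by blast
    then have "m = n" using bdis unfolding F_def by blast
    then have "shift (length (bs n)) x \<in> G n i \<inter> G n j" using x unfolding F_def by auto
    then show ?thesis using dis[of n] p \<open>m = n\<close> unfolding pairwise_def disjnt_def by blast
  qed
  show thesis using that cellular_image[where I="Sigma UNIV I" and F=F, OF Fop Fne Fdis] by blast
qed

section \<open>Small bases from separating functions\<close>

text \<open>Finite intersections of preimages of rational intervals form a base: by compactness,
  finitely many interval conditions that hold at \<open>x\<close> exclude all points outside a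
  neighbourhood \<open>U\<close> of \<open>x\<close>.\<close>

lemma base_of_separating_family:
  fixes f :: "'k \<Rightarrow> 'a \<Rightarrow> real"
  assumes comp: "compact_space X"
    and cont: "\<And>\<alpha>. \<alpha> \<in> K \<Longrightarrow> continuous_map X euclideanreal (f \<alpha>)"
    and sep: "\<And>x y. x \<in> topspace X \<Longrightarrow> y \<in> topspace X \<Longrightarrow> x \<noteq> y \<Longrightarrow> \<exists>\<alpha>\<in>K. f \<alpha> x \<noteq> f \<alpha> y"
  obtains \<B> where "is_base X \<B>" "\<B> \<lesssim> lists (K \<times> (UNIV :: (rat \<times> rat) set))"
proof -
  define cyl where "cyl ts = {x \<in> topspace X. \<forall>(\<alpha>, q, r)\<in>set ts. f \<alpha> x \<in> {of_rat q<..<of_rat r}}"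
    for ts :: "('k \<times> rat \<times> rat) list"
  define \<T> where "\<T> = lists (K \<times> (UNIV :: (rat \<times> rat) set))"
  have cyl_open: "openin X (cyl ts)" if "ts \<in> \<T>" for ts
  proof -
    have "openin X {x \<in> topspace X. f \<alpha> x \<in> {of_rat q<..<of_rat r}}" if "\<alpha> \<in> K" for \<alpha> q r
      by (rule openin_continuous_map_preimage[OF cont[OF that]]) auto
    then have "openin X (\<Inter>(insert (topspace X)
        ((\<lambda>(\<alpha>, q, r). {x \<in> topspace X. f \<alpha> x \<in> {of_rat q<..<of_rat r}}) ` set ts)))"
      using that unfolding \<T>_def by (intro openin_Inter) auto
    moreover have "\<Inter>(insert (topspace X)
        ((\<lambda>(\<alpha>, q, r). {x \<in> topspace X. f \<alpha> x \<in> {of_rat q<..<of_rat r}}) ` set ts)) = cyl ts"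
      unfolding cyl_def by auto
    ultimately show ?thesis by simp
  qed
  have cyl_nbd: "\<exists>ts\<in>\<T>. x \<in> cyl ts \<and> cyl ts \<subseteq> U" if U: "openin X U" "x \<in> U" for U x
  proof -
    have xt: "x \<in> topspace X" using U openin_subset by blast
    define Q where "Q = {(\<alpha>, q, r). \<alpha> \<in> K \<and> f \<alpha> x \<in> {of_rat q<..<of_rat r}}"
    \<comment> \<open>Complements of closed intervals give open sets, as compactness requires, and
      these miss the cylinder over the open interval with the same ends.\<close>
    define co where "co = (\<lambda>(\<alpha>, q, r). {y \<in> topspace X. f \<alpha> y \<in> - {of_rat q..of_rat r}})"
    have co_open: "openin X (co t)" if "t \<in> Q" for t
    proof -
      obtain \<alpha> q r where t: "t = (\<alpha>, q, r)" "\<alpha> \<in> K" using \<open>t \<in> Q\<close> unfolding Q_def by (cases t) auto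
      show ?thesis unfolding co_def t(1) prod.case
        by (rule openin_continuous_map_preimage[OF cont[OF t(2)]]) auto
    qed
    have "\<exists>t\<in>Q. y \<in> co t" if y: "y \<in> topspace X - U" for y
    proof -
      have "y \<noteq> x" using y U by blast
      then obtain \<alpha> where \<alpha>: "\<alpha> \<in> K" "f \<alpha> x \<noteq> f \<alpha> y" using sep xt y by blast
      \<comment> \<open>Rational ends within \<open>e\<close> of \<open>f \<alpha> x\<close> exclude
        \<open>f \<alpha> y\<close>, which is at distance exactly \<open>e\<close>.\<close>
      define e where "e = \<bar>f \<alpha> x - f \<alpha> y\<bar>"
      have "e > 0" using \<alpha> unfolding e_def by simp
      obtain q where q: "f \<alpha> x - e < of_rat q" "of_rat q < f \<alpha> x"
        using of_rat_dense[of "f \<alpha> x - e" "f \<alpha> x"] \<open>e > 0\<close> by auto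
      obtain r where r: "f \<alpha> x < of_rat r" "of_rat r < f \<alpha> x + e"
        using of_rat_dense[of "f \<alpha> x" "f \<alpha> x + e"] \<open>e > 0\<close> by auto
      have "f \<alpha> y \<notin> {of_rat q..of_rat r}" using q r unfolding e_def by auto
      then have "(\<alpha>, q, r) \<in> Q" "y \<in> co (\<alpha>, q, r)" using \<alpha> q r y unfolding Q_def co_def by auto
      then show ?thesis by blast
    qed
    then have "topspace X \<subseteq> \<Union>(insert U (co ` Q))" by blast
    moreover have "\<forall>V\<in>insert U (co ` Q). openin X V" using U co_open by blast
    ultimately obtain \<F> where \<F>: "finite \<F>" "\<F> \<subseteq> insert U (co ` Q)" "topspace X \<subseteq> \<Union>\<F>"
      using comp unfolding compact_space_alt by meson
    have "finite (\<F> - {U})" "\<F> - {U} \<subseteq> co ` Q" using \<F> by auto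
    then obtain Q' where Q': "finite Q'" "Q' \<subseteq> Q" "\<F> - {U} = co ` Q'"
      using finite_subset_image by metis
    obtain ts where ts: "set ts = Q'" using finite_list[OF Q'(1)] by blast
    have "ts \<in> \<T>" using ts Q' unfolding \<T>_def Q_def by auto
    moreover have "x \<in> cyl ts" using xt ts Q' unfolding cyl_def Q_def by auto
    moreover have "cyl ts \<subseteq> U"
    proof
      fix y assume y: "y \<in> cyl ts"
      then have "y \<in> \<Union>\<F>" using \<F>(3) unfolding cyl_def by blast
      moreover have "y \<notin> co t" if "t \<in> Q'" for t
        using y that ts unfolding cyl_def co_def by fastforce
      ultimately show "y \<in> U" using Q'(3) by blast
    qed
    ultimately show ?thesis by blast
  qed
  show thesis
  proof (rule that[of "cyl ` \<T>"])
    show "cyl ` \<T> \<lesssim> lists (K \<times> (UNIV :: (rat \<times> rat) set))" unfolding \<T>_def by (rule image_lepoll)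
    show "is_base X (cyl ` \<T>)"
      unfolding is_base_def
    proof (intro conjI ballI allI impI)
      show "openin X B" if "B \<in> cyl ` \<T>" for B using that cyl_open by blast
      fix U assume "openin X U"
      then have "\<Union>{B \<in> cyl ` \<T>. B \<subseteq> U} = U" using cyl_nbd by blast
      then show "\<exists>\<V>\<subseteq>cyl ` \<T>. \<Union>\<V> = U"
        by (intro exI[of _ "{B \<in> cyl ` \<T>. B \<subseteq> U}"] conjI) auto
    qed
  qed
qed

section \<open>Separated sets in a dense metrizable subspace\<close>

text \<open>Maximality under inclusion gives the covering property: a point at distance at least
  \<open>e\<close> from all of \<open>A\<close> could be added.\<close>

lemma maximal_separated_set:
  fixes d :: "'b \<Rightarrow> 'b \<Rightarrow> real"
  assumes "\<And>x y. d x y = d y x" "\<And>x. x \<in> M \<Longrightarrow> d x x = 0" "e > 0"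
  obtains A where "A \<subseteq> M" "\<And>x y. x \<in> A \<Longrightarrow> y \<in> A \<Longrightarrow> d x y < e \<Longrightarrow> x = y"
    "\<And>x. x \<in> M \<Longrightarrow> \<exists>a\<in>A. d a x < e"
proof -
  define \<A> where "\<A> = {A. A \<subseteq> M \<and> (\<forall>x\<in>A. \<forall>y\<in>A. d x y < e \<longrightarrow> x = y)}"
  have "\<exists>A\<in>\<A>. \<forall>B\<in>\<A>. A \<subseteq> B \<longrightarrow> B = A"
  proof (rule subset_Zorn')
    fix \<C> assume C: "subset.chain \<A> \<C>"
    have "x = y" if "x \<in> P" "P \<in> \<C>" "y \<in> Q" "Q \<in> \<C>" "d x y < e" for x y P Q
    proof -
      have "P \<subseteq> Q \<or> Q \<subseteq> P" "P \<in> \<A>" "Q \<in> \<A>" using C that unfolding subset_chain_def by blast+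
      then show ?thesis using that unfolding \<A>_def by blast
    qed
    then show "\<Union>\<C> \<in> \<A>" using C unfolding subset_chain_def \<A>_def by blast
  qed
  then obtain A where A: "A \<in> \<A>" "\<And>B. B \<in> \<A> \<Longrightarrow> A \<subseteq> B \<Longrightarrow> B = A" by blast
  have "\<exists>a\<in>A. d a x < e" if x: "x \<in> M" for x
  proof (rule ccontr)
    assume no: "\<not> ?thesis"
    then have "\<not> d a x < e" "\<not> d x a < e" if "a \<in> A" for a
      using that assms(1)[of x a] by auto
    then have "insert x A \<in> \<A>" using A(1) x unfolding \<A>_def by blast
    then have "x \<in> A" using A(2) by blast
    then show False using no assms(2)[OF x] assms(3) by auto
  qed
  moreover have "A \<subseteq> M" "\<And>x y. x \<in> A \<Longrightarrow> y \<in> A \<Longrightarrow> d x y < e \<Longrightarrow> x = y"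
    using A(1) unfolding \<A>_def by auto
  ultimately show thesis by (intro that)
qed

text \<open>Balls of half the separation radius around a maximal separated subset of the dense metric
  space are traces of pairwise disjoint open sets of the whole space.\<close>
lemma dense_metrizable_sigma_cellular:
  assumes "has_dense_metrizable_subspace Z" "topspace Z \<noteq> {}"
  obtains A :: "nat \<Rightarrow> 'b set" and G :: "nat \<Rightarrow> 'b \<Rightarrow> 'b set" where
    "Z closure_of (\<Union>n. A n) = topspace Z"
    "\<forall>n. A n \<subseteq> topspace Z \<and> A n \<noteq> {} \<and> pairwise (\<lambda>a b. disjnt (G n a) (G n b)) (A n)"
    "\<forall>n. \<forall>a\<in>A n. openin Z (G n a) \<and> a \<in> G n a"
proof -
  obtain D where D: "D \<subseteq> topspace Z" "Z closure_of D = topspace Z" "metrizable_space (subtopology Z D)"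
    using assms unfolding has_dense_metrizable_subspace_def by blast
  obtain M d where "Metric_space M d" and top: "subtopology Z D = Metric_space.mtopology M d"
    using D(3) unfolding metrizable_space_def by blast
  interpret Metric_space M d by fact
  have "topspace (subtopology Z D) = D" using D(1) by auto
  then have MD: "M = D" using top by simp
  define e where "e n = inverse (real (Suc n))" for n
  have e: "e n > 0" for n unfolding e_def by simp
  have "\<exists>A. A \<subseteq> M \<and> (\<forall>x\<in>A. \<forall>y\<in>A. d x y < e n \<longrightarrow> x = y) \<and> (\<forall>x\<in>M. \<exists>a\<in>A. d a x < e n)" for n
    using maximal_separated_set[of d M "e n", OF commute _ e] by (metis mdist_zero)
  then obtain A where A: "\<And>n. A n \<subseteq> M" "\<And>n x y. x \<in> A n \<Longrightarrow> y \<in> A n \<Longrightarrow> d x y < e n \<Longrightarrow> x = y"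
    "\<And>n x. x \<in> M \<Longrightarrow> \<exists>a\<in>A n. d a x < e n" by metis
  have "\<forall>n a. \<exists>G. openin Z G \<and> mball a (e n / 2) = G \<inter> D"
    using openin_mball unfolding top[symmetric] openin_subtopology by blast
  then have "\<exists>G. \<forall>n a. openin Z (G n a) \<and> mball a (e n / 2) = G n a \<inter> D"
    by (simp only: choice_iff)
  then obtain G where G: "\<And>n a. openin Z (G n a)" "\<And>n a. mball a (e n / 2) = G n a \<inter> D" by blast
  have Asub: "A n \<subseteq> topspace Z" for n using A(1) D(1) MD by blast
  have dense: "Z closure_of (\<Union>n. A n) = topspace Z"
    unfolding dense_intersects_open
  proof (intro allI impI, elim conjE)
    fix U assume U: "openin Z U" "U \<noteq> {}"
    then obtain x where x: "x \<in> D" "x \<in> U" using D(2) unfolding dense_intersects_open by blast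
    have "openin mtopology (U \<inter> D)" using U unfolding top[symmetric] openin_subtopology by blast
    then obtain r where r: "r > 0" "mball x r \<subseteq> U \<inter> D" using x unfolding openin_mtopology by blast
    obtain n where "e n < r" using reals_Archimedean[OF r(1)] unfolding e_def by blast
    obtain a where a: "a \<in> A n" "d a x < e n" using A(3) x MD by blast
    moreover have "a \<in> M" "x \<in> M" using A(1)[of n] x(1) MD a(1) by auto
    ultimately have "a \<in> mball x r" using \<open>e n < r\<close> commute[of a x] by (simp add: in_mball)
    then show "(\<Union>n. A n) \<inter> U \<noteq> {}" using a(1) r(2) by blast
  qed
  have Ane: "A n \<noteq> {}" for n
  proof -
    have "D \<noteq> {}" using D(2) assms(2) by (metis closure_of_empty)
    then show ?thesis using A(3) MD by blast
  qed
  have GA: "a \<in> G n a" if "a \<in> A n" for n a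
    using G(2)[of a n] centre_in_mball_iff[of a "e n / 2"] e[of n] A(1)[of n] that by auto
  have "a = b" if ab: "a \<in> A n" "b \<in> A n" "G n a \<inter> G n b \<noteq> {}" for n a b
  proof -
    \<comment> \<open>By density the intersection contains a point of \<open>D\<close>, which lies
      in both balls; the triangle inequality then puts \<open>a\<close> and \<open>b\<close> within
      \<open>e n\<close>.\<close>
    have "openin Z (G n a \<inter> G n b)" by (intro openin_Int G(1))
    then have "D \<inter> (G n a \<inter> G n b) \<noteq> {}" using D(2) ab(3) unfolding dense_intersects_open by metis
    then obtain z where z: "z \<in> mball a (e n / 2)" "z \<in> mball b (e n / 2)" using G(2) by blast
    then have "d a b < e n" using triangle[of a z b] commute[of z b] by (auto simp: in_mball)
    then show ?thesis using A(2) ab by blast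
  qed
  then have Gdis: "pairwise (\<lambda>a b. disjnt (G n a) (G n b)) (A n)" for n
    unfolding pairwise_def disjnt_def by blast
  show thesis
    using dense Asub Ane Gdis G(1) GA by (intro that[of A G]) auto
qed

section \<open>Bounding the weight by a cellular family\<close>

text \<open>A coordinate outside \<open>T\<close> vanishes at all components of points of
  \<open>A\<close>, hence by density on all of \<open>X\<close>; so the coordinates in
  \<open>T\<close> separate points. Each point of \<open>A\<close> contributes countably many of
  them, whence \<open>T \<lesssim> S\<close>.\<close>

lemma corson_family_base_of_dense:
  assumes comp: "compact_space X" and cf: "corson_family X K f"
    and A: "A \<subseteq> topspace (power_omega X)" "power_omega X closure_of A = topspace (power_omega X)"
    and S: "infinite S" "A \<lesssim> S"
  obtains \<B> where "is_base X \<B>" "\<B> \<lesssim> S"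
proof -
  define T where "T = (\<Union>(a, i)\<in>A \<times> UNIV. {\<alpha>\<in>K. f \<alpha> (a i) \<noteq> 0})"
  have natS: "(UNIV :: nat set) \<lesssim> S" using S(1) infinite_le_lepoll by blast
  have "A \<times> (UNIV :: nat set) \<lesssim> S \<times> (UNIV :: nat set)" using S(2) by (intro times_lepoll_mono) auto
  also have "\<dots> \<lesssim> S" using S(1) natS by (rule infinite_times_lepoll)
  finally have AS: "|A \<times> (UNIV :: nat set)| \<le>o |S|" by (simp add: lepoll_iff_card_of_ordLeq)
  have "T \<lesssim> S"
    unfolding T_def lepoll_iff_card_of_ordLeq
  proof (rule card_of_UNION_ordLeq_infinite[OF S(1) AS], intro ballI)
    fix p assume "p \<in> A \<times> (UNIV :: nat set)"
    then obtain a i where p: "p = (a, i)" "a \<in> A" by auto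
    then have "a i \<in> topspace X" using A(1) by (auto simp: topspace_power_omega)
    then have "countable {\<alpha>\<in>K. f \<alpha> (a i) \<noteq> 0}" using cf unfolding corson_family_def by blast
    then have "{\<alpha>\<in>K. f \<alpha> (a i) \<noteq> 0} \<lesssim> (UNIV :: nat set)"
      unfolding countable_def lepoll_def by auto
    then have "{\<alpha>\<in>K. f \<alpha> (a i) \<noteq> 0} \<lesssim> S" using natS by (rule lepoll_trans)
    then show "|case p of (a, i) \<Rightarrow> {\<alpha>\<in>K. f \<alpha> (a i) \<noteq> 0}| \<le>o |S|"
      using p by (simp add: lepoll_iff_card_of_ordLeq)
  qed
  have ratS: "(UNIV :: (rat \<times> rat) set) \<lesssim> S"
  proof -
    have "(UNIV :: (rat \<times> rat) set) \<lesssim> (UNIV :: nat set)"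
      unfolding lepoll_def using inj_to_nat by blast
    then show ?thesis using natS lepoll_trans by blast
  qed
  have "T \<times> (UNIV :: (rat \<times> rat) set) \<lesssim> S \<times> (UNIV :: (rat \<times> rat) set)"
    using \<open>T \<lesssim> S\<close> by (intro times_lepoll_mono) auto
  also have "\<dots> \<lesssim> S" using S(1) ratS by (rule infinite_times_lepoll)
  finally have "lists (T \<times> (UNIV :: (rat \<times> rat) set)) \<lesssim> lists S" by (rule lists_lepoll_mono)
  also have "lists S \<lesssim> S" using S(1) by (rule lists_lepoll_infinite)
  finally have TS: "lists (T \<times> (UNIV :: (rat \<times> rat) set)) \<lesssim> S" .
  have TK: "T \<subseteq> K" unfolding T_def by auto
  have zero: "f \<alpha> z = 0" if \<alpha>: "\<alpha> \<in> K" "\<alpha> \<notin> T" and z: "z \<in> topspace X" for \<alpha> z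
  proof (rule ccontr)
    assume "f \<alpha> z \<noteq> 0"
    \<comment> \<open>The condition is placed on factor 0, and the constant sequence at
      \<open>z\<close> shows that \<open>U\<close> is nonempty.\<close>
    define U where "U = {x \<in> topspace (power_omega X). x (0::nat) \<in> {w \<in> topspace X. f \<alpha> w \<in> - {0}}}"
    have "openin X {w \<in> topspace X. f \<alpha> w \<in> - {0}}"
      using cf \<alpha> unfolding corson_family_def
      by (intro openin_continuous_map_preimage[of X euclideanreal]) auto
    then have "openin (power_omega X) U"
      unfolding U_def by (rule openin_continuous_map_preimage[OF continuous_map_power_omega_component])
    moreover have "(\<lambda>_. z) \<in> U" using z \<open>f \<alpha> z \<noteq> 0\<close> unfolding U_def by (auto simp: topspace_power_omega)
    ultimately have "A \<inter> U \<noteq> {}" using A(2) unfolding dense_intersects_open by blast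
    then obtain a where "a \<in> A" "f \<alpha> (a 0) \<noteq> 0" unfolding U_def by blast
    then show False using \<alpha> unfolding T_def by blast
  qed
  have sep: "\<exists>\<alpha>\<in>T. f \<alpha> x \<noteq> f \<alpha> y" if xy: "x \<in> topspace X" "y \<in> topspace X" "x \<noteq> y" for x y
  proof -
    obtain \<alpha> where \<alpha>: "\<alpha> \<in> K" "f \<alpha> x \<noteq> f \<alpha> y" using cf xy unfolding corson_family_def by blast
    then have "\<alpha> \<in> T" using zero[of \<alpha> x] zero[of \<alpha> y] xy by force
    then show ?thesis using \<alpha> by blast
  qed
  have cont: "continuous_map X euclideanreal (f \<alpha>)" if "\<alpha> \<in> T" for \<alpha>
    using cf TK that unfolding corson_family_def by blast
  obtain \<B> where "is_base X \<B>" "\<B> \<lesssim> lists (T \<times> (UNIV :: (rat \<times> rat) set))"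
    using base_of_separating_family[of X T f, OF comp cont sep] by blast
  then show thesis using that TS lepoll_trans by blast
qed

text \<open>If \<open>X\<close> has two points, then \<open>\<B> \<lesssim> \<B>' \<lesssim> Sigma
  UNIV A \<lesssim> \<U>\<close>, by minimality of the weight base, density of the union of the
  \<open>A n\<close>, and disjoint cylinders that separate the levels.\<close>

lemma dense_metrizable_imp_chat_greater:
  assumes X: "compact_space X" "Hausdorff_space X" and cf: "corson_family X K f"
    and weight: "weight_base X \<B>" and dm: "has_dense_metrizable_subspace (power_omega X)"
  shows "chat_greater (power_omega X) \<B>"
proof -
  let ?Z = "power_omega X"
  have min: "\<B> \<lesssim> \<B>'" if "is_base X \<B>'" for \<B>'
    using weight that unfolding weight_base_def lepoll_iff_card_of_ordLeq by blast
  show ?thesis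
  proof (cases "\<exists>a b. a \<in> topspace X \<and> b \<in> topspace X \<and> a \<noteq> b")
    case False
    have triv: "U = {} \<or> U = topspace X" if "openin X U" for U
      using openin_subset[OF that] False by blast
    \<comment> \<open>With at most one point there are no two disjoint nonempty open sets, but this
      base has at most one element. Removing the empty set covers empty \<open>X\<close>, where the
      base and the cellular family are both empty.\<close>
    define \<D> where "\<D> = {topspace X} - {{}}"
    have "is_base X \<D>"
      unfolding is_base_def
    proof (intro conjI ballI allI impI)
      show "openin X B" if "B \<in> \<D>" for B using that unfolding \<D>_def by auto
      fix U assume "openin X U"
      from triv[OF this] show "\<exists>\<V>\<subseteq>\<D>. \<Union>\<V> = U"
      proof
        assume "U = {}" then show ?thesis by (intro exI[of _ "{}"]) auto
      next
        assume "U = topspace X" then show ?thesis by (intro exI[of _ \<D>]) (auto simp: \<D>_def)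
      qed
    qed
    have "\<B> \<lesssim> \<D>" using min[OF \<open>is_base X \<D>\<close>] .
    also have "\<D> \<lesssim> {topspace ?Z} - {{}}"
    proof (cases "topspace X = {}")
      case True then show ?thesis unfolding \<D>_def by simp
    next
      case False
      then obtain a where "a \<in> topspace X" by blast
      then have "(\<lambda>_. a) \<in> topspace ?Z" by (simp add: topspace_power_omega)
      then have "{topspace ?Z} - {{}} = {topspace ?Z}" by auto
      moreover have "\<D> = {topspace X}" using False unfolding \<D>_def by auto
      ultimately show ?thesis by (simp only: singleton_lepoll)
    qed
    finally show ?thesis
      by (rule chat_greater_if_lepoll_cellular[rotated]) (auto simp: cellular_def pairwise_def)
  next
    case True
    then obtain a b where ab: "a \<in> topspace X" "b \<in> topspace X" "a \<noteq> b" by blast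
    then have "(\<lambda>_. a) \<in> topspace ?Z" by (simp add: topspace_power_omega)
    then have ne: "topspace ?Z \<noteq> {}" by blast
    obtain A :: "nat \<Rightarrow> (nat \<Rightarrow> 'a) set" and G
      where dense: "?Z closure_of (\<Union>n. A n) = topspace ?Z"
        and A: "\<forall>n. A n \<subseteq> topspace ?Z \<and> A n \<noteq> {} \<and> pairwise (\<lambda>a b. disjnt (G n a) (G n b)) (A n)"
        and G: "\<forall>n. \<forall>a\<in>A n. openin ?Z (G n a) \<and> a \<in> G n a"
      using dense_metrizable_sigma_cellular[OF dm ne] .
    have Gop: "openin ?Z (G n x)" "G n x \<noteq> {}" if "x \<in> A n" for n x using G that by auto
    have Gdis: "pairwise (\<lambda>a b. disjnt (G n a) (G n b)) (A n)" for n using A by simp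
    obtain \<U> where \<U>: "cellular ?Z \<U>" "Sigma UNIV A \<lesssim> \<U>"
      using cellular_power_omega_Sigma[of X a b A G, OF X(2) ab Gop Gdis] .
    \<comment> \<open>As no \<open>A n\<close> is empty, the sum projects onto the naturals. It is
      infinite even if every \<open>A n\<close> is finite, as
      \<open>corson_family_base_of_dense\<close> requires.\<close>
    have "fst ` Sigma UNIV A = UNIV" using A by (simp add: fst_image_Sigma)
    then have inf: "infinite (Sigma UNIV A)" by (metis finite_imageI infinite_UNIV_nat)
    have "(\<Union>n. A n) \<subseteq> snd ` Sigma UNIV A" by (simp add: snd_image_Sigma)
    then have "(\<Union>n. A n) \<lesssim> Sigma UNIV A" by (rule subset_image_lepoll)
    moreover have "(\<Union>n. A n) \<subseteq> topspace ?Z" using A by blast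
    ultimately obtain \<B>' where \<B>': "is_base X \<B>'" "\<B>' \<lesssim> Sigma UNIV A"
      using corson_family_base_of_dense[OF X(1) cf _ dense inf] by blast
    have "\<B> \<lesssim> \<B>'" using \<B>'(1) by (rule min)
    also note \<B>'(2)
    also note \<U>(2)
    finally show ?thesis by (rule chat_greater_if_lepoll_cellular[OF \<U>(1)])
  qed
qed

theorem theorem3:
  fixes X :: "'a topology" and K :: "'k set" and \<B> :: "'a set set"
  assumes "Corson_compactum_on X K"
    and "weight_base X \<B>"
  shows "has_dense_metrizable_subspace (power_omega X) \<longleftrightarrow> chat_greater (power_omega X) \<B>"
proof -
  have X: "compact_space X" "Hausdorff_space X" using assms(1) unfolding Corson_compactum_on_def by auto
  obtain f where f: "corson_family X K f" using Corson_compactum_imp_family[OF assms(1)] .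
  have base: "is_base X \<B>" using assms(2) unfolding weight_base_def by blast
  show ?thesis
    using dense_metrizable_imp_chat_greater[OF X f assms(2)] chat_greater_imp_dense_metrizable[OF X f base]
    by blast
qed

end
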